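(* Let $\mathcal V$ be a constructively completely distributive unital commutative quantale, $F,T\colon\mathsf{Set}\to\mathsf{Set}$ functors such that $T$ preserves weak pullbacks and $F$ preserves intersections, $\zeta\colon T\circ F\Rightarrow F\circ T$ a natural transformation, and $(X,\alpha\colon TX\to X,\xi\colon X\to FX)$ a bialgebra for $\zeta$. Define monotone maps $f,b$ on $\mathcal V\text{-}\mathsf{Rel}_X$ by $f(d)=\alpha_*(\bar T_{can}(d))$ and $b(d)=\bar F_{can}(d)\circ(\xi\times\xi)$. Then $f$ is $b$-compatible, i.e. $f(b(d))\le b(f(d))$ for all $d\in\mathcal V\text{-}\mathsf{Rel}_X$.
   Context: A unital commutative quantale $\mathcal V$ is a complete lattice $(\mathcal V,\le)$ with an associative, commutative operation $\otimes$ distributing over arbitrary joins $\bigvee$, with unit $1$. It is constructively completely distributive if $v=\bigvee\{u\mid u\lll v\}$ for all $v$, where $u\lll v$ means: for every $W\subseteq\mathcal V$ with $v\le\bigvee W$ there is $w\in W$ with $u\le w$. $\mathcal V\text{-}\mathsf{Rel}_Y$ is the lattice of maps $Y\times Y\to\mathcal V$ (pointwise order). A bialgebra for $\zeta$ is a triple $(X,\alpha,\xi)$ with $F\alpha\circ\zeta_X\circ T\xi=\xi\circ\alpha$. For $g\colon Y\to Z$ and $r\in\mathcal V\text{-}\mathsf{Rel}_Y$, $g_*(r)(z,z')=\bigvee\{r(y,y')\mid g(y)=z,g(y')=z'\}$. For a functor $G$ and $r\in\mathcal V$, ${\uparrow}r=\{v\mid v\ge r\}$ with inclusion $\iota_r$,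 and $u\in G({\uparrow}r)$ means $u$ is in the image of $G\iota_r$; the canonical predicate lifting is $\hat G_{can}(p)(u)=\bigvee\{r\mid G(p)(u)\in G({\uparrow}r)\}$ for $p\colon Y\to\mathcal V$, $u\in GY$; the canonical Wasserstein lifting is $\bar G_{can}(r)(t_1,t_2)=\bigvee\{\hat G_{can}(r)(t)\mid t\in G(Y\times Y),G\pi_1(t)=t_1,G\pi_2(t)=t_2\}$ for $r\colon Y\times Y\to\mathcal V$ (viewed as a predicate on $Y\times Y$) and $t_1,t_2\in GY$.
   Formalization: The formal theorem additionally assumes that the canonical Wasserstein lifting of F is monotone on V-Rel_Y for every set Y; this does not follow from F preserving intersections, and the claim fails without it. Monotonicity of f is not part of the formal conclusion. *)

theory Defs
  imports "HOL-Library.FuncSet"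
begin

section \<open>Quantales\<close>

class unital_comm_quantale = complete_lattice + comm_monoid_mult +
  assumes mult_Sup_distrib: "x * Sup A = (SUP a\<in>A. x * a)"

definition (in complete_lattice) totally_below :: "'a \<Rightarrow> 'a \<Rightarrow> bool" (infix \<open>\<lless>\<close> 50)
  where "u \<lless> v \<longleftrightarrow> (\<forall>W. v \<le> Sup W \<longrightarrow> (\<exists>w\<in>W. u \<le> w))"

class ccd_quantale = unital_comm_quantale +
  assumes ccd: "v = Sup {u. u \<lless> v}"


section \<open>The category of sets\<close>

text \<open>
  HOL has no type of all sets, so the category of sets is represented relative to a universe: its
  objects are the members of a collection \<open>U\<close> of subsets of a type \<open>'u\<close>, and its morphisms from
  \<open>A\<close> to \<open>B\<close> are \<^emph>\<open>all\<close> functions, i.e. the elements of \<open>A \<rightarrow>\<^sub>E B\<close>. Only closure under subsets and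
  under binary products (coded by an injective pairing) is required of \<open>U\<close>, so that the
  sets of a Grothendieck universe are an instance. The members of the quantale are coded as
  elements of \<open>'u\<close> by \<open>val\<close>, whose range is the object \<open>V\<close>.
\<close>

locale set_universe =
  fixes U :: "'u set set" and pair :: "'u \<times> 'u \<Rightarrow> 'u" and val :: "'v \<Rightarrow> 'u"
  assumes subset_closed: "A \<in> U \<Longrightarrow> B \<subseteq> A \<Longrightarrow> B \<in> U"
    and prod_closed: "A \<in> U \<Longrightarrow> B \<in> U \<Longrightarrow> pair ` (A \<times> B) \<in> U"
    and inj_pair: "inj pair"
    and inj_val: "inj val"
    and range_val: "range val \<in> U"

abbreviation incl :: "'u set \<Rightarrow> 'u \<Rightarrow> 'u"
  where "incl A \<equiv> (\<lambda>a\<in>A. a)"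

text \<open>The action of a functor on a morphism depends on the domain \<open>A\<close> and the codomain \<open>B\<close>.\<close>

record 'u endofunctor =
  obj :: "'u set \<Rightarrow> 'u set"
  arr :: "'u set \<Rightarrow> 'u set \<Rightarrow> ('u \<Rightarrow> 'u) \<Rightarrow> 'u \<Rightarrow> 'u"

definition is_functor :: "'u set set \<Rightarrow> 'u endofunctor \<Rightarrow> bool"
  where "is_functor U G \<longleftrightarrow>
    (\<forall>A\<in>U. obj G A \<in> U) \<and>
    (\<forall>A\<in>U. \<forall>B\<in>U. \<forall>f \<in> A \<rightarrow>\<^sub>E B. arr G A B f \<in> obj G A \<rightarrow>\<^sub>E obj G B) \<and>
    (\<forall>A\<in>U. arr G A A (incl A) = incl (obj G A)) \<and>
    (\<forall>A\<in>U. \<forall>B\<in>U. \<forall>C\<in>U. \<forall>f \<in> A \<rightarrow>\<^sub>E B. \<forall>g \<in> B \<rightarrow>\<^sub>E C.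
       arr G A C (compose A g f) = compose (obj G A) (arr G B C g) (arr G A B f))"

definition functor_comp :: "'u endofunctor \<Rightarrow> 'u endofunctor \<Rightarrow> 'u endofunctor"  (infixr \<open>\<odot>\<close> 75)
  where "G \<odot> H = \<lparr> obj = (\<lambda>A. obj G (obj H A)),
                   arr = (\<lambda>A B f. arr G (obj H A) (obj H B) (arr H A B f)) \<rparr>"

definition natural_transformation ::
  "'u set set \<Rightarrow> 'u endofunctor \<Rightarrow> 'u endofunctor \<Rightarrow> ('u set \<Rightarrow> 'u \<Rightarrow> 'u) \<Rightarrow> bool"
  where "natural_transformation U G H \<eta> \<longleftrightarrow>
    (\<forall>A\<in>U. \<eta> A \<in> obj G A \<rightarrow>\<^sub>E obj H A) \<and>
    (\<forall>A\<in>U. \<forall>B\<in>U. \<forall>f \<in> A \<rightarrow>\<^sub>E B.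
       compose (obj G A) (arr H A B f) (\<eta> A) = compose (obj G A) (\<eta> B) (arr G A B f))"

text \<open>The square with legs \<open>p : P \<rightarrow> A\<close>, \<open>q : P \<rightarrow> B\<close> over \<open>f : A \<rightarrow> C\<close>, \<open>g : B \<rightarrow> C\<close>.\<close>

definition weak_pullback ::
  "'u set set \<Rightarrow> 'u set \<Rightarrow> 'u set \<Rightarrow> 'u set \<Rightarrow> 'u set \<Rightarrow>
   ('u \<Rightarrow> 'u) \<Rightarrow> ('u \<Rightarrow> 'u) \<Rightarrow> ('u \<Rightarrow> 'u) \<Rightarrow> ('u \<Rightarrow> 'u) \<Rightarrow> bool"
  where "weak_pullback U P A B C p q f g \<longleftrightarrow>
    p \<in> P \<rightarrow>\<^sub>E A \<and> q \<in> P \<rightarrow>\<^sub>E B \<and> f \<in> A \<rightarrow>\<^sub>E C \<and> g \<in> B \<rightarrow>\<^sub>E C \<and>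
    compose P f p = compose P g q \<and>
    (\<forall>Q\<in>U. \<forall>h \<in> Q \<rightarrow>\<^sub>E A. \<forall>k \<in> Q \<rightarrow>\<^sub>E B. compose Q f h = compose Q g k \<longrightarrow>
       (\<exists>m \<in> Q \<rightarrow>\<^sub>E P. compose Q p m = h \<and> compose Q q m = k))"

definition preserves_weak_pullbacks :: "'u set set \<Rightarrow> 'u endofunctor \<Rightarrow> bool"
  where "preserves_weak_pullbacks U G \<longleftrightarrow>
    (\<forall>P\<in>U. \<forall>A\<in>U. \<forall>B\<in>U. \<forall>C\<in>U. \<forall>p q f g. weak_pullback U P A B C p q f g \<longrightarrow>
       weak_pullback U (obj G P) (obj G A) (obj G B) (obj G C)
         (arr G P A p) (arr G P B q) (arr G A C f) (arr G B C g))"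

text \<open>The cone with legs \<open>p i : P \<rightarrow> B i\<close> over the family \<open>m i : B i \<rightarrow> A\<close>, for \<open>i \<in> I \<noteq> {}\<close>.\<close>

definition wide_pullback ::
  "'u set set \<Rightarrow> 'i set \<Rightarrow> 'u set \<Rightarrow> ('i \<Rightarrow> 'u set) \<Rightarrow> 'u set \<Rightarrow>
   ('i \<Rightarrow> 'u \<Rightarrow> 'u) \<Rightarrow> ('i \<Rightarrow> 'u \<Rightarrow> 'u) \<Rightarrow> bool"
  where "wide_pullback U I P B A p m \<longleftrightarrow>
    (\<forall>i\<in>I. p i \<in> P \<rightarrow>\<^sub>E B i \<and> m i \<in> B i \<rightarrow>\<^sub>E A) \<and>
    (\<forall>i\<in>I. \<forall>j\<in>I. compose P (m i) (p i) = compose P (m j) (p j)) \<and>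
    (\<forall>Q\<in>U. \<forall>h. (\<forall>i\<in>I. h i \<in> Q \<rightarrow>\<^sub>E B i) \<and>
         (\<forall>i\<in>I. \<forall>j\<in>I. compose Q (m i) (h i) = compose Q (m j) (h j)) \<longrightarrow>
       (\<exists>!k. k \<in> Q \<rightarrow>\<^sub>E P \<and> (\<forall>i\<in>I. compose Q (p i) k = h i)))"

text \<open>
  Arbitrary, not just finite, intersections. The index type \<open>'u set\<close> is large enough for every
  collection of subsets of an object.
\<close>

definition preserves_intersections :: "'u set set \<Rightarrow> 'u endofunctor \<Rightarrow> bool"
  where "preserves_intersections U G \<longleftrightarrow>
    (\<forall>A\<in>U. \<forall>(I :: 'u set set) S. I \<noteq> {} \<and> (\<forall>i\<in>I. S i \<subseteq> A) \<longrightarrow>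
       wide_pullback U I (obj G (\<Inter>i\<in>I. S i)) (\<lambda>i. obj G (S i)) (obj G A)
         (\<lambda>i. arr G (\<Inter>i\<in>I. S i) (S i) (incl (\<Inter>i\<in>I. S i)))
         (\<lambda>i. arr G (S i) A (incl (S i))))"

definition bialgebra ::
  "'u endofunctor \<Rightarrow> 'u endofunctor \<Rightarrow> ('u set \<Rightarrow> 'u \<Rightarrow> 'u) \<Rightarrow>
   'u set \<Rightarrow> ('u \<Rightarrow> 'u) \<Rightarrow> ('u \<Rightarrow> 'u) \<Rightarrow> bool"
  where "bialgebra T F \<zeta> X \<alpha> \<xi> \<longleftrightarrow>
    \<alpha> \<in> obj T X \<rightarrow>\<^sub>E X \<and> \<xi> \<in> X \<rightarrow>\<^sub>E obj F X \<and>
    compose (obj T X) (arr F (obj T X) X \<alpha>) (compose (obj T X) (\<zeta> X) (arr T X (obj F X) \<xi>)) =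
      compose (obj T X) \<xi> \<alpha>"


section \<open>Quantale-valued relations and canonical liftings\<close>

text \<open>
  A \<open>V\<close>-valued relation on \<open>Y\<close> is a function \<open>'u \<times> 'u \<Rightarrow> 'v\<close>; only its values on \<open>Y \<times> Y\<close> matter.
\<close>

definition rel_le :: "'u set \<Rightarrow> ('u \<times> 'u \<Rightarrow> 'v::order) \<Rightarrow> ('u \<times> 'u \<Rightarrow> 'v) \<Rightarrow> bool"
  where "rel_le Y r s \<longleftrightarrow> (\<forall>y\<in>Y. \<forall>y'\<in>Y. r (y, y') \<le> s (y, y'))"

definition push_forward ::
  "'u set \<Rightarrow> ('u \<Rightarrow> 'u) \<Rightarrow> ('u \<times> 'u \<Rightarrow> 'v::complete_lattice) \<Rightarrow> 'u \<times> 'u \<Rightarrow> 'v"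
  where "push_forward Y g r =
    (\<lambda>(z, z'). Sup {r (y, y') | y y'. y \<in> Y \<and> y' \<in> Y \<and> g y = z \<and> g y' = z'})"

definition can_pred_lifting ::
  "('v::complete_lattice \<Rightarrow> 'u) \<Rightarrow> 'u endofunctor \<Rightarrow> 'u set \<Rightarrow> ('u \<Rightarrow> 'v) \<Rightarrow> 'u \<Rightarrow> 'v"
  where "can_pred_lifting val G Y p u =
    Sup {r. arr G Y (range val) (\<lambda>y\<in>Y. val (p y)) u \<in>
            arr G (val ` {r..}) (range val) (incl (val ` {r..})) ` obj G (val ` {r..})}"

definition can_wasserstein ::
  "('u \<times> 'u \<Rightarrow> 'u) \<Rightarrow> ('v::complete_lattice \<Rightarrow> 'u) \<Rightarrow> 'u endofunctor \<Rightarrow> 'u set \<Rightarrow>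
   ('u \<times> 'u \<Rightarrow> 'v) \<Rightarrow> 'u \<times> 'u \<Rightarrow> 'v"
  where "can_wasserstein pair val G Y r =
    (let YY = pair ` (Y \<times> Y);
         \<pi>\<^sub>1 = (\<lambda>c\<in>YY. fst (inv pair c));
         \<pi>\<^sub>2 = (\<lambda>c\<in>YY. snd (inv pair c))
     in (\<lambda>(t\<^sub>1, t\<^sub>2).
       Sup {can_pred_lifting val G YY (r \<circ> inv pair) t | t.
              t \<in> obj G YY \<and> arr G YY Y \<pi>\<^sub>1 t = t\<^sub>1 \<and> arr G YY Y \<pi>\<^sub>2 t = t\<^sub>2}))"

text \<open>
  A lifting of \<open>G\<close> to \<open>V\<close>-valued relations acts monotonically on each fibre. For the canonical
  lifting this is not automatic, even if \<open>G\<close> preserves intersections.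
\<close>

definition monotone_wasserstein ::
  "'u set set \<Rightarrow> ('u \<times> 'u \<Rightarrow> 'u) \<Rightarrow> ('v::complete_lattice \<Rightarrow> 'u) \<Rightarrow> 'u endofunctor \<Rightarrow> bool"
  where "monotone_wasserstein U pair val G \<longleftrightarrow>
    (\<forall>Y\<in>U. \<forall>r s. rel_le Y r s \<longrightarrow>
       rel_le (obj G Y) (can_wasserstein pair val G Y r) (can_wasserstein pair val G Y s))"

definition algebra_map ::
  "('u \<times> 'u \<Rightarrow> 'u) \<Rightarrow> ('v::complete_lattice \<Rightarrow> 'u) \<Rightarrow> 'u endofunctor \<Rightarrow> 'u set \<Rightarrow> ('u \<Rightarrow> 'u) \<Rightarrow>
   ('u \<times> 'u \<Rightarrow> 'v) \<Rightarrow> 'u \<times> 'u \<Rightarrow> 'v"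
  where "algebra_map pair val T X \<alpha> d = push_forward (obj T X) \<alpha> (can_wasserstein pair val T X d)"

definition coalgebra_map ::
  "('u \<times> 'u \<Rightarrow> 'u) \<Rightarrow> ('v::complete_lattice \<Rightarrow> 'u) \<Rightarrow> 'u endofunctor \<Rightarrow> 'u set \<Rightarrow> ('u \<Rightarrow> 'u) \<Rightarrow>
   ('u \<times> 'u \<Rightarrow> 'v) \<Rightarrow> 'u \<times> 'u \<Rightarrow> 'v"
  where "coalgebra_map pair val F X \<xi> d = can_wasserstein pair val F X d \<circ> map_prod \<xi> \<xi>"

definition compatible ::
  "'u set \<Rightarrow> (('u \<times> 'u \<Rightarrow> 'v::order) \<Rightarrow> 'u \<times> 'u \<Rightarrow> 'v) \<Rightarrow>
   (('u \<times> 'u \<Rightarrow> 'v) \<Rightarrow> 'u \<times> 'u \<Rightarrow> 'v) \<Rightarrow> bool"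
  where "compatible X b f \<longleftrightarrow> (\<forall>d. rel_le X (f (b d)) (b (f d)))"

end

theory Submission
  imports Defs
begin

text \<open>
  Let \<open>t \<in> T (X \<times> X)\<close> couple \<open>t\<^sub>1, t\<^sub>2\<close> and let \<open>T (b d) t \<in> T (\<up>r)\<close>. As \<open>T\<close> preserves weak pullbacks,
  \<open>t\<close> comes from \<open>T R\<close> with \<open>R = {c. r \<le> b d c}\<close>. If \<open>r'\<close> is totally below \<open>r\<close>, every \<open>c \<in> R\<close> has a
  coupling \<open>\<sigma> c \<in> F (X \<times> X)\<close> with \<open>F d (\<sigma> c) \<in> F (\<up>r')\<close>. Then \<open>w = \<zeta> (T \<sigma> t) \<in> F (T (X \<times> X))\<close> has
  \<open>F (T \<pi>\<^sub>i) w = \<zeta> (T \<xi> t\<^sub>i)\<close>, and \<open>F (T d) w \<in> F (T (\<up>r'))\<close>, so the canonical lifting by \<open>F\<close> of the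
  canonical lifting of \<open>d\<close> by \<open>T\<close> is at least \<open>r'\<close> at \<open>w\<close>. The predicate lifting by \<open>F\<close> need not be
  monotone, so passing from it to \<open>f d\<close> is done on the set \<open>T (X \<times> X)\<close>: there, a predicate becomes a
  relation carried by the diagonal, to which monotonicity of the Wasserstein lifting applies. By
  complete distributivity \<open>r\<close> is the join of all such \<open>r'\<close>.
\<close>

section \<open>Functors and natural transformations on elements\<close>

lemma functor_obj: "is_functor U G \<Longrightarrow> A \<in> U \<Longrightarrow> obj G A \<in> U"
  by (simp add: is_functor_def)

lemma functor_arr:
  "is_functor U G \<Longrightarrow> A \<in> U \<Longrightarrow> B \<in> U \<Longrightarrow> f \<in> A \<rightarrow>\<^sub>E B \<Longrightarrow> arr G A B f \<in> obj G A \<rightarrow>\<^sub>E obj G B"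
  by (simp add: is_functor_def)

lemma functor_arr_mem:
  "is_functor U G \<Longrightarrow> A \<in> U \<Longrightarrow> B \<in> U \<Longrightarrow> f \<in> A \<rightarrow>\<^sub>E B \<Longrightarrow> u \<in> obj G A \<Longrightarrow> arr G A B f u \<in> obj G B"
  using functor_arr by (metis PiE_mem)

lemma functor_id: "is_functor U G \<Longrightarrow> A \<in> U \<Longrightarrow> u \<in> obj G A \<Longrightarrow> arr G A A (incl A) u = u"
  by (simp add: is_functor_def)

text \<open>Extensionality makes \<open>compose A g f\<close> equal to any morphism \<open>h\<close>
  with the same values on \<open>A\<close>. Taking \<open>h\<close> as a parameter leaves only
  pointwise equations to check in each use.\<close>

lemma functor_compose:
  assumes "is_functor U G" "A \<in> U" "B \<in> U" "C \<in> U" "f \<in> A \<rightarrow>\<^sub>E B" "g \<in> B \<rightarrow>\<^sub>E C" "h \<in> A \<rightarrow>\<^sub>E C"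
    and eq: "\<And>a. a \<in> A \<Longrightarrow> g (f a) = h a" and "u \<in> obj G A"
  shows "arr G B C g (arr G A B f u) = arr G A C h u"
proof -
  have "compose A g f = h"
    by (rule extensionalityI[of _ A]) (use assms(7) eq in \<open>auto simp: compose_def PiE_def\<close>)
  moreover have "arr G A C (compose A g f) = compose (obj G A) (arr G B C g) (arr G A B f)"
    using assms unfolding is_functor_def by blast
  ultimately show ?thesis using \<open>u \<in> obj G A\<close> by (simp add: compose_eq)
qed

lemma functor_square:
  assumes "is_functor U G" "A \<in> U" "B \<in> U" "B' \<in> U" "C \<in> U"
    and "f \<in> A \<rightarrow>\<^sub>E B" "g \<in> B \<rightarrow>\<^sub>E C" "f' \<in> A \<rightarrow>\<^sub>E B'" "g' \<in> B' \<rightarrow>\<^sub>E C"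
    and eq: "\<And>a. a \<in> A \<Longrightarrow> g (f a) = g' (f' a)" and u: "u \<in> obj G A"
  shows "arr G B C g (arr G A B f u) = arr G B' C g' (arr G A B' f' u)"
proof -
  have h: "compose A g' f' \<in> A \<rightarrow>\<^sub>E C" using assms by (auto simp: compose_def)
  have "arr G B C g (arr G A B f u) = arr G A C (compose A g' f') u"
    by (rule functor_compose[of U]) (use assms h in \<open>auto simp: compose_eq\<close>)
  also have "\<dots> = arr G B' C g' (arr G A B' f' u)"
    by (rule functor_compose[of U, symmetric]) (use assms h in \<open>auto simp: compose_eq\<close>)
  finally show ?thesis .
qed

lemma naturality_apply:
  assumes "natural_transformation U (T \<odot> F) (F \<odot> T) \<zeta>" "A \<in> U" "B \<in> U" "f \<in> A \<rightarrow>\<^sub>E B"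
    and u: "u \<in> obj T (obj F A)"
  shows "arr F (obj T A) (obj T B) (arr T A B f) (\<zeta> A u) =
    \<zeta> B (arr T (obj F A) (obj F B) (arr F A B f) u)"
proof -
  have "compose (obj (T \<odot> F) A) (arr (F \<odot> T) A B f) (\<zeta> A) =
      compose (obj (T \<odot> F) A) (\<zeta> B) (arr (T \<odot> F) A B f)"
    using assms unfolding natural_transformation_def by blast
  from fun_cong[OF this, of u] u show ?thesis by (simp add: functor_comp_def compose_eq)
qed

lemma natural_component_mem:
  assumes "natural_transformation U (T \<odot> F) (F \<odot> T) \<zeta>" "A \<in> U" "u \<in> obj T (obj F A)"
  shows "\<zeta> A u \<in> obj F (obj T A)"
  using assms unfolding natural_transformation_def functor_comp_def by force

section \<open>Inverse images as pullbacks, and weak pullbacks on elements\<close>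

lemma weak_pullback_preimage:
  assumes "p \<in> A \<rightarrow>\<^sub>E C" "S \<subseteq> C"
  defines "P \<equiv> {a \<in> A. p a \<in> S}"
  shows "weak_pullback U P A S C (incl P) (restrict p P) p (incl S)"
  unfolding weak_pullback_def
proof (intro conjI ballI impI)
  show "compose P p (incl P) = compose P (incl S) (restrict p P)"
    by (auto simp: compose_def P_def fun_eq_iff)
next
  fix Q h k assume h: "h \<in> Q \<rightarrow>\<^sub>E A" and k: "k \<in> Q \<rightarrow>\<^sub>E S"
    and "compose Q p h = compose Q (incl S) k"
  hence phk: "p (h x) = k x" if "x \<in> Q" for x
    using that k by (metis PiE_mem compose_eq restrict_apply')
  \<comment> \<open>The mediating map is \<open>h\<close> itself: \<open>p (h x) = k x\<close> lies
    in \<open>S\<close>, so \<open>h\<close> already lands in \<open>P\<close>.\<close>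
  have "h \<in> Q \<rightarrow>\<^sub>E P" using h k phk by (fastforce simp: P_def)
  moreover have "compose Q (incl P) h = h"
    by (rule extensionalityI[of _ Q]) (use h calculation in \<open>auto simp: compose_def PiE_def\<close>)
  moreover have "compose Q (restrict p P) h = k"
    by (rule extensionalityI[of _ Q]) (use k phk calculation in \<open>auto simp: compose_def PiE_def\<close>)
  ultimately show "\<exists>m\<in>Q \<rightarrow>\<^sub>E P. compose Q (incl P) m = h \<and> compose Q (restrict p P) m = k"
    by blast
qed (use assms in \<open>auto simp: P_def\<close>)

text \<open>Two elements with equal images form a cone whose apex is a singleton, and the mediating
  map out of it picks \<open>c\<close>.\<close>

lemma weak_pullback_element:
  assumes "weak_pullback U P A B C p q f g" "{z} \<in> U" "a \<in> A" "b \<in> B" "f a = g b"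
  obtains c where "c \<in> P" "p c = a" "q c = b"
proof -
  let ?h = "\<lambda>_\<in>{z}. a" and ?k = "\<lambda>_\<in>{z}. b"
  have "?h \<in> {z} \<rightarrow>\<^sub>E A" "?k \<in> {z} \<rightarrow>\<^sub>E B" "compose {z} f ?h = compose {z} g ?k"
    using assms by (auto simp: compose_def)
  then obtain m where m: "m \<in> {z} \<rightarrow>\<^sub>E P" "compose {z} p m = ?h" "compose {z} q m = ?k"
    using assms(1,2) unfolding weak_pullback_def by meson
  show thesis
  proof
    show "m z \<in> P" using m(1) by auto
    show "p (m z) = a" using fun_cong[OF m(2), of z] by (simp add: compose_eq)
    show "q (m z) = b" using fun_cong[OF m(3), of z] by (simp add: compose_eq)
  qed
qed

section \<open>Canonical liftings\<close>

abbreviation prod_set :: "('u \<times> 'u \<Rightarrow> 'u) \<Rightarrow> 'u set \<Rightarrow> 'u set"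
  where "prod_set pair Y \<equiv> pair ` (Y \<times> Y)"

abbreviation proj1 :: "('u \<times> 'u \<Rightarrow> 'u) \<Rightarrow> 'u set \<Rightarrow> 'u \<Rightarrow> 'u"
  where "proj1 pair Y \<equiv> (\<lambda>c\<in>prod_set pair Y. fst (inv pair c))"

abbreviation proj2 :: "('u \<times> 'u \<Rightarrow> 'u) \<Rightarrow> 'u set \<Rightarrow> 'u \<Rightarrow> 'u"
  where "proj2 pair Y \<equiv> (\<lambda>c\<in>prod_set pair Y. snd (inv pair c))"

abbreviation up_set :: "('v::order \<Rightarrow> 'u) \<Rightarrow> 'v \<Rightarrow> 'u set"
  where "up_set val r \<equiv> val ` {r..}"

abbreviation coded :: "('v \<Rightarrow> 'u) \<Rightarrow> 'u set \<Rightarrow> ('u \<Rightarrow> 'v) \<Rightarrow> 'u \<Rightarrow> 'u"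
  where "coded val Y p \<equiv> (\<lambda>y\<in>Y. val (p y))"

abbreviation image_up :: "('v::order \<Rightarrow> 'u) \<Rightarrow> 'u endofunctor \<Rightarrow> 'v \<Rightarrow> 'u set"
  where "image_up val G r \<equiv>
    arr G (up_set val r) (range val) (incl (up_set val r)) ` obj G (up_set val r)"

lemma le_can_pred_lifting:
  "arr G Y (range val) (coded val Y p) u \<in> image_up val G r \<Longrightarrow> r \<le> can_pred_lifting val G Y p u"
  unfolding can_pred_lifting_def by (rule Sup_upper) simp

lemma can_pred_lifting_cong:
  "(\<And>y. y \<in> Y \<Longrightarrow> p y = q y) \<Longrightarrow> can_pred_lifting val G Y p = can_pred_lifting val G Y q"
  unfolding can_pred_lifting_def by (simp cong: restrict_cong)

locale lattice_universe = set_universe U pair val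
  for U :: "'u set set" and pair :: "'u \<times> 'u \<Rightarrow> 'u" and val :: "'v::complete_lattice \<Rightarrow> 'u"
begin

lemma up_set_mem: "up_set val r \<in> U"
  by (rule subset_closed[OF range_val]) auto

lemma prod_set_mem: "Y \<in> U \<Longrightarrow> prod_set pair Y \<in> U"
  by (rule prod_closed)

lemma inv_pair [simp]: "inv pair (pair c) = c"
  using inj_pair by (rule inv_f_f)

lemma proj1_mem: "proj1 pair Y \<in> prod_set pair Y \<rightarrow>\<^sub>E Y"
  and proj2_mem: "proj2 pair Y \<in> prod_set pair Y \<rightarrow>\<^sub>E Y"
  by auto

section \<open>Predicate liftings: thresholds, reindexing and inverse images of up-sets\<close>

lemma image_up_antimono:
  assumes G: "is_functor U G" and le: "r' \<le> r"
  shows "image_up val G r \<subseteq> image_up val G r'"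
proof clarify
  fix u assume u: "u \<in> obj G (up_set val r)"
  have sub: "incl (up_set val r) \<in> up_set val r \<rightarrow>\<^sub>E up_set val r'" using le by auto
  \<comment> \<open>The inclusion of \<open>up_set val r\<close> into \<open>range val\<close>
    factors through \<open>up_set val r'\<close>.\<close>
  have "arr G (up_set val r') (range val) (incl (up_set val r'))
      (arr G (up_set val r) (up_set val r') (incl (up_set val r)) u) =
    arr G (up_set val r) (range val) (incl (up_set val r)) u"
    by (rule functor_compose[OF G up_set_mem up_set_mem range_val sub])
       (use u le in \<open>auto intro: order_trans\<close>)
  with functor_arr_mem[OF G up_set_mem up_set_mem sub u]
  show "arr G (up_set val r) (range val) (incl (up_set val r)) u \<in> image_up val G r'"
    by (metis image_eqI)
qed

text \<open>Coding \<open>p\<close> and precomposing with \<open>h\<close> is the same as coding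
  \<open>p\<close> after \<open>h\<close>, so by functoriality both joins range over the same
  thresholds.\<close>

lemma can_pred_lifting_natural:
  assumes "is_functor U G" "A \<in> U" "B \<in> U" "h \<in> A \<rightarrow>\<^sub>E B" "u \<in> obj G A"
  shows "can_pred_lifting val G B p (arr G A B h u) = can_pred_lifting val G A (\<lambda>a. p (h a)) u"
proof -
  have "arr G B (range val) (coded val B p) (arr G A B h u) =
      arr G A (range val) (coded val A (\<lambda>a. p (h a))) u"
    by (rule functor_compose[of U]) (use assms range_val in \<open>auto simp: PiE_mem\<close>)
  thus ?thesis unfolding can_pred_lifting_def by simp
qed

text \<open>The part of \<open>Y\<close> where \<open>p\<close> is at least \<open>r\<close> is the
  inverse image of the up-set, and \<open>G\<close> keeps this square a weak pullback. Since
  \<open>u\<close> and its witness over the up-set have the same image, both come from one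
  \<open>t\<close>.\<close>

lemma preimage_up_set_lift:
  assumes G: "is_functor U G" "preserves_weak_pullbacks U G" and Y: "Y \<in> U"
    and u: "u \<in> obj G Y" and mem: "arr G Y (range val) (coded val Y p) u \<in> image_up val G r"
  obtains t where "t \<in> obj G {y \<in> Y. r \<le> p y}"
    "arr G {y \<in> Y. r \<le> p y} Y (incl {y \<in> Y. r \<le> p y}) t = u"
proof -
  define P where "P = {y \<in> Y. coded val Y p y \<in> up_set val r}"
  have P: "P = {y \<in> Y. r \<le> p y}"
    using inj_val by (auto simp: P_def inj_image_mem_iff)
  have PU: "P \<in> U" by (rule subset_closed[OF Y]) (auto simp: P_def)
  have "weak_pullback U P Y (up_set val r) (range val) (incl P) (restrict (coded val Y p) P)
      (coded val Y p) (incl (up_set val r))"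
    unfolding P_def by (rule weak_pullback_preimage) auto
  hence wp: "weak_pullback U (obj G P) (obj G Y) (obj G (up_set val r)) (obj G (range val))
      (arr G P Y (incl P)) (arr G P (up_set val r) (restrict (coded val Y p) P))
      (arr G Y (range val) (coded val Y p))
      (arr G (up_set val r) (range val) (incl (up_set val r)))"
    using G(2) PU Y up_set_mem range_val unfolding preserves_weak_pullbacks_def by blast
  have "{u} \<in> U" by (rule subset_closed[OF functor_obj[OF G(1) Y]]) (use u in auto)
  moreover obtain v where "v \<in> obj G (up_set val r)" "arr G Y (range val) (coded val Y p) u =
      arr G (up_set val r) (range val) (incl (up_set val r)) v" using mem by blast
  ultimately obtain t where "t \<in> obj G P" "arr G P Y (incl P) t = u"
    using weak_pullback_element[OF wp _ u] by metis
  thus thesis using that unfolding P by blast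
qed

section \<open>Couplings, the Wasserstein lifting and its relation to predicate liftings\<close>

lemma can_wasserstein_upper:
  assumes "t \<in> obj G (prod_set pair Y)"
  shows "can_pred_lifting val G (prod_set pair Y) (r \<circ> inv pair) t \<le>
    can_wasserstein pair val G Y r
      (arr G (prod_set pair Y) Y (proj1 pair Y) t, arr G (prod_set pair Y) Y (proj2 pair Y) t)"
  unfolding can_wasserstein_def Let_def using assms by (auto intro!: Sup_upper)

text \<open>The product map carries a coupling of \<open>w\<^sub>1\<close> and
  \<open>w\<^sub>2\<close> to a coupling of their images with the same predicate value. Only an
  inequality results, since couplings over \<open>Z\<close> may fail to come from
  \<open>Y\<close>.\<close>

lemma can_wasserstein_reindex:
  assumes G: "is_functor U G" and Y: "Y \<in> U" and Z: "Z \<in> U"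
    and a: "a\<^sub>1 \<in> Y \<rightarrow>\<^sub>E Z" "a\<^sub>2 \<in> Y \<rightarrow>\<^sub>E Z"
  shows "can_wasserstein pair val G Y (r \<circ> map_prod a\<^sub>1 a\<^sub>2) (w\<^sub>1, w\<^sub>2) \<le>
    can_wasserstein pair val G Z r (arr G Y Z a\<^sub>1 w\<^sub>1, arr G Y Z a\<^sub>2 w\<^sub>2)"
proof -
  let ?Y = "prod_set pair Y" and ?Z = "prod_set pair Z"
  define h where "h = (\<lambda>c\<in>?Y. pair (map_prod a\<^sub>1 a\<^sub>2 (inv pair c)))"
  have h: "h \<in> ?Y \<rightarrow>\<^sub>E ?Z" using a by (auto simp: h_def PiE_mem)
  note YZ = prod_set_mem[OF Y] prod_set_mem[OF Z]
  have "can_pred_lifting val G ?Y ((r \<circ> map_prod a\<^sub>1 a\<^sub>2) \<circ> inv pair) s \<le>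
      can_wasserstein pair val G Z r (arr G Y Z a\<^sub>1 (arr G ?Y Y (proj1 pair Y) s),
        arr G Y Z a\<^sub>2 (arr G ?Y Y (proj2 pair Y) s))" if s: "s \<in> obj G ?Y" for s
  proof -
    have 1: "arr G ?Z Z (proj1 pair Z) (arr G ?Y ?Z h s) =
        arr G Y Z a\<^sub>1 (arr G ?Y Y (proj1 pair Y) s)"
      by (rule functor_square[OF G YZ Y Z h proj1_mem proj1_mem a(1) _ s])
         (use a in \<open>auto simp: h_def PiE_mem\<close>)
    have 2: "arr G ?Z Z (proj2 pair Z) (arr G ?Y ?Z h s) =
        arr G Y Z a\<^sub>2 (arr G ?Y Y (proj2 pair Y) s)"
      by (rule functor_square[OF G YZ Y Z h proj2_mem proj2_mem a(2) _ s])
         (use a in \<open>auto simp: h_def PiE_mem\<close>)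
    have "can_pred_lifting val G ?Y ((r \<circ> map_prod a\<^sub>1 a\<^sub>2) \<circ> inv pair) s =
        can_pred_lifting val G ?Y (\<lambda>c. (r \<circ> inv pair) (h c)) s"
      by (rule fun_cong[OF can_pred_lifting_cong]) (auto simp: h_def)
    also have "\<dots> = can_pred_lifting val G ?Z (r \<circ> inv pair) (arr G ?Y ?Z h s)"
      using can_pred_lifting_natural[OF G YZ h s] by metis
    also have "\<dots> \<le> can_wasserstein pair val G Z r
        (arr G ?Z Z (proj1 pair Z) (arr G ?Y ?Z h s), arr G ?Z Z (proj2 pair Z) (arr G ?Y ?Z h s))"
      by (rule can_wasserstein_upper[OF functor_arr_mem[OF G YZ h s]])
    finally show ?thesis unfolding 1 2 .
  qed
  thus ?thesis
    unfolding can_wasserstein_def[of _ _ _ Y] Let_def by (auto intro!: Sup_least)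
qed

text \<open>The image of \<open>w\<close> under the diagonal map couples \<open>w\<close> with
  itself, and by naturality its value is the lifting of \<open>\<rho>\<close> restricted to the
  diagonal.\<close>

lemma can_pred_lifting_le_can_wasserstein_diagonal:
  assumes G: "is_functor U G" and Y: "Y \<in> U" and w: "w \<in> obj G Y"
  shows "can_pred_lifting val G Y (\<lambda>y. \<rho> (y, y)) w \<le> can_wasserstein pair val G Y \<rho> (w, w)"
proof -
  let ?D = "prod_set pair Y"
  define \<Delta> where "\<Delta> = (\<lambda>y\<in>Y. pair (y, y))"
  have \<Delta>: "\<Delta> \<in> Y \<rightarrow>\<^sub>E ?D" by (auto simp: \<Delta>_def)
  note D = prod_set_mem[OF Y]
  have 1: "arr G ?D Y (proj1 pair Y) (arr G Y ?D \<Delta> w) = arr G Y Y (incl Y) w"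
    by (rule functor_compose[OF G Y D Y \<Delta> proj1_mem _ _ w]) (auto simp: \<Delta>_def)
  have 2: "arr G ?D Y (proj2 pair Y) (arr G Y ?D \<Delta> w) = arr G Y Y (incl Y) w"
    by (rule functor_compose[OF G Y D Y \<Delta> proj2_mem _ _ w]) (auto simp: \<Delta>_def)
  have "can_pred_lifting val G Y (\<lambda>y. \<rho> (y, y)) w =
      can_pred_lifting val G Y (\<lambda>y. (\<rho> \<circ> inv pair) (\<Delta> y)) w"
    by (rule fun_cong[OF can_pred_lifting_cong]) (auto simp: \<Delta>_def)
  also have "\<dots> = can_pred_lifting val G ?D (\<rho> \<circ> inv pair) (arr G Y ?D \<Delta> w)"
    using can_pred_lifting_natural[OF G Y D \<Delta> w] by metis
  also have "\<dots> \<le> can_wasserstein pair val G Y \<rho> (w, w)"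
    using can_wasserstein_upper[OF functor_arr_mem[OF G Y D \<Delta> w], of \<rho>]
    unfolding 1 2 functor_id[OF G Y w] .
  finally show ?thesis .
qed

lemma can_pred_lifting_le_can_wasserstein:
  assumes G: "is_functor U G" "monotone_wasserstein U pair val G" and Y: "Y \<in> U" and Z: "Z \<in> U"
    and a: "a\<^sub>1 \<in> Y \<rightarrow>\<^sub>E Z" "a\<^sub>2 \<in> Y \<rightarrow>\<^sub>E Z" and w: "w \<in> obj G Y"
    and le: "\<And>y. y \<in> Y \<Longrightarrow> p y \<le> r (a\<^sub>1 y, a\<^sub>2 y)"
  shows "can_pred_lifting val G Y p w \<le>
    can_wasserstein pair val G Z r (arr G Y Z a\<^sub>1 w, arr G Y Z a\<^sub>2 w)"
proof -
  \<comment> \<open>\<open>\<rho>\<close> is \<open>p\<close> on the diagonal and agrees with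
    \<open>r\<close> after the two maps elsewhere, so \<open>le\<close> alone compares the two
    relations on all of \<open>Y \<times> Y\<close>.\<close>
  define \<rho> where "\<rho> = (\<lambda>(y, y'). if y = y' then p y else r (a\<^sub>1 y, a\<^sub>2 y'))"
  have "can_pred_lifting val G Y p w \<le> can_wasserstein pair val G Y \<rho> (w, w)"
    using can_pred_lifting_le_can_wasserstein_diagonal[OF G(1) Y w, of \<rho>] by (simp add: \<rho>_def)
  also have "\<dots> \<le> can_wasserstein pair val G Y (r \<circ> map_prod a\<^sub>1 a\<^sub>2) (w, w)"
  proof -
    have "rel_le Y \<rho> (r \<circ> map_prod a\<^sub>1 a\<^sub>2)" using le by (auto simp: rel_le_def \<rho>_def)
    with G(2) Y have "rel_le (obj G Y) (can_wasserstein pair val G Y \<rho>)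
        (can_wasserstein pair val G Y (r \<circ> map_prod a\<^sub>1 a\<^sub>2))"
      unfolding monotone_wasserstein_def by blast
    thus ?thesis using w unfolding rel_le_def by blast
  qed
  also have "\<dots> \<le> can_wasserstein pair val G Z r (arr G Y Z a\<^sub>1 w, arr G Y Z a\<^sub>2 w)"
    by (rule can_wasserstein_reindex[OF G(1) Y Z a])
  finally show ?thesis .
qed

text \<open>The lifting by \<open>T\<close> factors as \<open>T p\<close> followed by an evaluation
  \<open>ev\<close>, which sends the image of \<open>T\<close> of the up-set of \<open>r\<close>
  into that up-set. Applying \<open>F ev\<close> to \<open>eq\<close> thus turns \<open>w'\<close>
  into a witness in \<open>F\<close> of the up-set.\<close>

lemma le_can_pred_lifting_comp:
  assumes F: "is_functor U F" and T: "is_functor U T" and A: "A \<in> U"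
    and w: "w \<in> obj F (obj T A)" and w': "w' \<in> obj F (obj T (up_set val r))"
    and eq: "arr F (obj T A) (obj T (range val)) (arr T A (range val) (coded val A p)) w =
      arr F (obj T (up_set val r)) (obj T (range val))
        (arr T (up_set val r) (range val) (incl (up_set val r))) w'"
  shows "r \<le> can_pred_lifting val F (obj T A) (can_pred_lifting val T A p) w"
proof (rule le_can_pred_lifting)
  let ?V = "range val" and ?R = "up_set val r"
  \<comment> \<open>On \<open>T\<close> of the value object, \<open>ev\<close> codes the canonical
    lifting by \<open>T\<close> of the identity predicate.\<close>
  define ev where "ev = (\<lambda>c\<in>obj T ?V. val (Sup {s. c \<in> image_up val T s}))"
  let ?\<iota> = "arr T ?R ?V (incl ?R)"
  have ev: "ev \<in> obj T ?V \<rightarrow>\<^sub>E ?V" by (auto simp: ev_def)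
  have \<iota>: "?\<iota> \<in> obj T ?R \<rightarrow>\<^sub>E obj T ?V" by (rule functor_arr[OF T up_set_mem range_val]) auto
  have p: "arr T A ?V (coded val A p) \<in> obj T A \<rightarrow>\<^sub>E obj T ?V"
    by (rule functor_arr[OF T A range_val]) auto
  note obj = functor_obj[OF T A] functor_obj[OF T range_val] functor_obj[OF T up_set_mem]
  have ev_mem: "ev (?\<iota> c) \<in> ?R" if c: "c \<in> obj T ?R" for c
  proof -
    have "r \<le> Sup {s. ?\<iota> c \<in> image_up val T s}" by (rule Sup_upper) (use c in auto)
    thus ?thesis using PiE_mem[OF \<iota> c] by (auto simp: ev_def)
  qed
  \<comment> \<open>\<open>ev'\<close> is \<open>ev\<close> corestricted over the up-set; the square
    \<open>ev\<close> after \<open>\<iota>\<close> equals inclusion after \<open>ev'\<close> is what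
    \<open>F\<close> is applied to below.\<close>
  define ev' where "ev' = (\<lambda>c\<in>obj T ?R. ev (?\<iota> c))"
  have ev': "ev' \<in> obj T ?R \<rightarrow>\<^sub>E ?R" using ev_mem by (auto simp: ev'_def)
  have "arr F (obj T A) ?V (coded val (obj T A) (can_pred_lifting val T A p)) w =
      arr F (obj T ?V) ?V ev (arr F (obj T A) (obj T ?V) (arr T A ?V (coded val A p)) w)"
    by (rule functor_compose[OF F obj(1,2) range_val p ev, symmetric])
       (use w PiE_mem[OF p] in \<open>auto simp: ev_def can_pred_lifting_def\<close>)
  also have "\<dots> = arr F ?R ?V (incl ?R) (arr F (obj T ?R) ?R ev' w')"
    unfolding eq
    by (rule functor_square[OF F obj(3,2) up_set_mem range_val \<iota> ev ev'])
       (use w' ev_mem in \<open>auto simp: ev'_def\<close>)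
  finally show "arr F (obj T A) ?V (coded val (obj T A) (can_pred_lifting val T A p)) w
      \<in> image_up val F r"
    using functor_arr_mem[OF F obj(3) up_set_mem ev' w'] by (metis image_eqI)
qed

text \<open>The Wasserstein value is a join of joins, hence below the join of the single set
  \<open>W\<close> of thresholds met by some coupling with the given marginals. Total belowness
  yields a member of \<open>W\<close> above \<open>r'\<close>, even when the join is not
  attained.\<close>

lemma coupling_of_totally_below:
  assumes G: "is_functor U G" and below: "r' \<lless> r"
    and le: "r \<le> can_wasserstein pair val G Y d (z\<^sub>1, z\<^sub>2)"
  obtains s where "s \<in> obj G (prod_set pair Y)"
    "arr G (prod_set pair Y) Y (proj1 pair Y) s = z\<^sub>1"
    "arr G (prod_set pair Y) Y (proj2 pair Y) s = z\<^sub>2"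
    "arr G (prod_set pair Y) (range val) (coded val (prod_set pair Y) (d \<circ> inv pair)) s
      \<in> image_up val G r'"
proof -
  let ?Y = "prod_set pair Y"
  define W where "W = {q. \<exists>s. s \<in> obj G ?Y \<and> arr G ?Y Y (proj1 pair Y) s = z\<^sub>1 \<and>
    arr G ?Y Y (proj2 pair Y) s = z\<^sub>2 \<and>
    arr G ?Y (range val) (coded val ?Y (d \<circ> inv pair)) s \<in> image_up val G q}"
  have "can_wasserstein pair val G Y d (z\<^sub>1, z\<^sub>2) \<le> Sup W"
    unfolding can_wasserstein_def can_pred_lifting_def Let_def prod.case
    by (rule Sup_least, clarify, rule Sup_subset_mono) (unfold W_def, blast)
  with le have "r \<le> Sup W" by (rule order_trans)
  with below obtain q where "q \<in> W" "r' \<le> q" unfolding totally_below_def by blast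
  with image_up_antimono[OF G \<open>r' \<le> q\<close>] that show thesis unfolding W_def by blast
qed

end

section \<open>Compatibility\<close>

text \<open>This is the case of one coupling \<open>t\<close>, one threshold \<open>r\<close> met by
  it and one \<open>r'\<close> totally below \<open>r\<close>; the joins over these are taken in the
  theorem.\<close>

lemma (in lattice_universe) totally_below_le_coalgebra_algebra_map:
  assumes F: "is_functor U F" "monotone_wasserstein U pair val F"
    and T: "is_functor U T" "preserves_weak_pullbacks U T"
    and nat: "natural_transformation U (T \<odot> F) (F \<odot> T) \<zeta>"
    and X: "X \<in> U" and bialg: "bialgebra T F \<zeta> X \<alpha> \<xi>"
    and t: "t \<in> obj T (prod_set pair X)"
    and mem: "arr T (prod_set pair X) (range val)
        (coded val (prod_set pair X) (coalgebra_map pair val F X \<xi> d \<circ> inv pair)) t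
      \<in> image_up val T r"
    and below: "r' \<lless> r"
  shows "r' \<le> coalgebra_map pair val F X \<xi> (algebra_map pair val T X \<alpha> d)
    (\<alpha> (arr T (prod_set pair X) X (proj1 pair X) t), \<alpha> (arr T (prod_set pair X) X (proj2 pair X) t))"
proof -
  let ?V = "range val" and ?XX = "prod_set pair X" and ?R' = "up_set val r'"
  let ?p = "coded val ?XX (d \<circ> inv pair)"
  define R where "R = {c \<in> ?XX. r \<le> (coalgebra_map pair val F X \<xi> d \<circ> inv pair) c}"
  have \<alpha>: "\<alpha> \<in> obj T X \<rightarrow>\<^sub>E X" and \<xi>: "\<xi> \<in> X \<rightarrow>\<^sub>E obj F X"
    using bialg by (auto simp: bialgebra_def)
  note XX = prod_set_mem[OF X]
  have R: "R \<in> U" by (rule subset_closed[OF XX]) (auto simp: R_def)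
  obtain t' where t': "t' \<in> obj T R" "arr T R ?XX (incl R) t' = t"
    using preimage_up_set_lift[OF T XX t mem] unfolding R_def by blast
  \<comment> \<open>Each coupling \<open>s\<close> is chosen together with a witness
    \<open>v\<close> of its threshold, so that both choices become maps on \<open>R\<close> to which
    \<open>T\<close> applies.\<close>
  have "\<exists>s v. s \<in> obj F ?XX \<and> v \<in> obj F ?R' \<and>
      arr F ?XX X (proj1 pair X) s = \<xi> (proj1 pair X c) \<and>
      arr F ?XX X (proj2 pair X) s = \<xi> (proj2 pair X c) \<and>
      arr F ?XX ?V ?p s = arr F ?R' ?V (incl ?R') v" if c: "c \<in> R" for c
  proof -
    have "r \<le> can_wasserstein pair val F X d (\<xi> (proj1 pair X c), \<xi> (proj2 pair X c))"
      using c by (auto simp: R_def coalgebra_map_def)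
    from coupling_of_totally_below[OF F(1) below this] show ?thesis by blast
  qed
  then obtain \<sigma>0 \<tau>0 where \<sigma>\<tau>: "\<And>c. c \<in> R \<Longrightarrow> \<sigma>0 c \<in> obj F ?XX \<and> \<tau>0 c \<in> obj F ?R' \<and>
      arr F ?XX X (proj1 pair X) (\<sigma>0 c) = \<xi> (proj1 pair X c) \<and>
      arr F ?XX X (proj2 pair X) (\<sigma>0 c) = \<xi> (proj2 pair X c) \<and>
      arr F ?XX ?V ?p (\<sigma>0 c) = arr F ?R' ?V (incl ?R') (\<tau>0 c)"
    by metis
  define \<sigma> \<tau> where "\<sigma> = restrict \<sigma>0 R" and "\<tau> = restrict \<tau>0 R"
  have \<sigma>: "\<sigma> \<in> R \<rightarrow>\<^sub>E obj F ?XX" and \<tau>: "\<tau> \<in> R \<rightarrow>\<^sub>E obj F ?R'"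
    using \<sigma>\<tau> by (auto simp: \<sigma>_def \<tau>_def)
  note FX = functor_obj[OF F(1) X] and FXX = functor_obj[OF F(1) XX]
    and FV = functor_obj[OF F(1) range_val] and FR' = functor_obj[OF F(1) up_set_mem]
    and TX = functor_obj[OF T(1) X] and TXX = functor_obj[OF T(1) XX]
  define y where "y = arr T R (obj F ?XX) \<sigma> t'"
  define z where "z = arr T R (obj F ?R') \<tau> t'"
  define w where "w = \<zeta> ?XX y"
  define w' where "w' = \<zeta> ?R' z"
  have y: "y \<in> obj T (obj F ?XX)"
    unfolding y_def by (rule functor_arr_mem[OF T(1) R FXX \<sigma> t'(1)])
  have z: "z \<in> obj T (obj F ?R')"
    unfolding z_def by (rule functor_arr_mem[OF T(1) R FR' \<tau> t'(1)])
  have w: "w \<in> obj F (obj T ?XX)"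
    unfolding w_def by (rule natural_component_mem[OF nat XX y])
  have w': "w' \<in> obj F (obj T ?R')"
    unfolding w'_def by (rule natural_component_mem[OF nat up_set_mem z])
  have p: "?p \<in> ?XX \<rightarrow>\<^sub>E ?V" and \<iota>: "incl ?R' \<in> ?R' \<rightarrow>\<^sub>E ?V" and inclR: "incl R \<in> R \<rightarrow>\<^sub>E ?XX"
    by (auto simp: R_def)
  \<comment> \<open>On \<open>R\<close>, couplings and witnesses agree in \<open>F\<close> of the
    value object. \<open>T\<close> preserves this equation, and naturality of \<open>\<zeta>\<close>
    then carries it to \<open>w\<close> and \<open>w'\<close>.\<close>
  have "arr T (obj F ?XX) (obj F ?V) (arr F ?XX ?V ?p) y =
      arr T (obj F ?R') (obj F ?V) (arr F ?R' ?V (incl ?R')) z"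
    unfolding y_def z_def
    by (rule functor_square[OF T(1) R FXX FR' FV \<sigma> functor_arr[OF F(1) XX range_val p]
          \<tau> functor_arr[OF F(1) up_set_mem range_val \<iota>] _ t'(1)])
       (use \<sigma>\<tau> in \<open>simp add: \<sigma>_def \<tau>_def\<close>)
  hence "arr F (obj T ?XX) (obj T ?V) (arr T ?XX ?V ?p) w =
      arr F (obj T ?R') (obj T ?V) (arr T ?R' ?V (incl ?R')) w'"
    unfolding w_def w'_def naturality_apply[OF nat XX range_val p y]
      naturality_apply[OF nat up_set_mem range_val \<iota> z] by simp
  hence "r' \<le> can_pred_lifting val F (obj T ?XX) (can_pred_lifting val T ?XX (d \<circ> inv pair)) w"
    by (rule le_can_pred_lifting_comp[OF F(1) T(1) XX w w'])
  \<comment> \<open>The legs are \<open>\<alpha>\<close> after \<open>T\<close> of the projections.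
    The pointwise bound holds since each \<open>u\<close> couples its own marginals and the
    push-forward joins over all \<open>\<alpha>\<close>-preimages.\<close>
  also have "\<dots> \<le> can_wasserstein pair val F X (algebra_map pair val T X \<alpha> d)
      (arr F (obj T ?XX) X (compose (obj T ?XX) \<alpha> (arr T ?XX X (proj1 pair X))) w,
       arr F (obj T ?XX) X (compose (obj T ?XX) \<alpha> (arr T ?XX X (proj2 pair X))) w)"
  proof (rule can_pred_lifting_le_can_wasserstein[OF F TXX X _ _ w])
    note mem1 = functor_arr[OF T(1) XX X proj1_mem] and mem2 = functor_arr[OF T(1) XX X proj2_mem]
    show "compose (obj T ?XX) \<alpha> (arr T ?XX X (proj1 pair X)) \<in> obj T ?XX \<rightarrow>\<^sub>E X"
      using mem1 \<alpha> by (auto simp: compose_def)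
    show "compose (obj T ?XX) \<alpha> (arr T ?XX X (proj2 pair X)) \<in> obj T ?XX \<rightarrow>\<^sub>E X"
      using mem2 \<alpha> by (auto simp: compose_def)
    fix u assume u: "u \<in> obj T ?XX"
    have "can_wasserstein pair val T X d
        (arr T ?XX X (proj1 pair X) u, arr T ?XX X (proj2 pair X) u) \<le>
      algebra_map pair val T X \<alpha> d
        (\<alpha> (arr T ?XX X (proj1 pair X) u), \<alpha> (arr T ?XX X (proj2 pair X) u))"
      using PiE_mem[OF mem1 u] PiE_mem[OF mem2 u]
      unfolding algebra_map_def push_forward_def by (auto intro!: Sup_upper)
    with can_wasserstein_upper[OF u, of d]
    show "can_pred_lifting val T ?XX (d \<circ> inv pair) u \<le> algebra_map pair val T X \<alpha> d
        (compose (obj T ?XX) \<alpha> (arr T ?XX X (proj1 pair X)) u,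
         compose (obj T ?XX) \<alpha> (arr T ?XX X (proj2 pair X)) u)"
      unfolding compose_eq[OF u] by (rule order_trans)
  qed
  also have "\<dots> = coalgebra_map pair val F X \<xi> (algebra_map pair val T X \<alpha> d)
      (\<alpha> (arr T ?XX X (proj1 pair X) t), \<alpha> (arr T ?XX X (proj2 pair X) t))"
  proof -
    \<comment> \<open>One chain serves both projections: functoriality of \<open>F\<close>,
      naturality of \<open>\<zeta>\<close>, the marginals of \<open>\<sigma>\<close> on
      \<open>R\<close>, the fact that \<open>t'\<close> lies over \<open>t\<close>, and finally the
      bialgebra law.\<close>
    have marginal: "arr F (obj T ?XX) X (compose (obj T ?XX) \<alpha> (arr T ?XX X \<pi>)) w =
        \<xi> (\<alpha> (arr T ?XX X \<pi> t))"
      if \<pi>: "\<pi> \<in> ?XX \<rightarrow>\<^sub>E X" and eq: "\<And>c. c \<in> R \<Longrightarrow> arr F ?XX X \<pi> (\<sigma> c) = \<xi> (\<pi> c)" for \<pi>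
    proof -
      note T\<pi> = functor_arr[OF T(1) XX X \<pi>]
      have "compose (obj T ?XX) \<alpha> (arr T ?XX X \<pi>) \<in> obj T ?XX \<rightarrow>\<^sub>E X"
        using T\<pi> \<alpha> by (auto simp: compose_def)
      hence "arr F (obj T ?XX) X (compose (obj T ?XX) \<alpha> (arr T ?XX X \<pi>)) w =
          arr F (obj T X) X \<alpha> (arr F (obj T ?XX) (obj T X) (arr T ?XX X \<pi>) w)"
        by (intro functor_compose[OF F(1) TXX TX X T\<pi> \<alpha> _ _ w, symmetric]) (auto simp: compose_eq)
      also have "arr F (obj T ?XX) (obj T X) (arr T ?XX X \<pi>) w =
          \<zeta> X (arr T (obj F ?XX) (obj F X) (arr F ?XX X \<pi>) y)"
        unfolding w_def by (rule naturality_apply[OF nat XX X \<pi> y])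
      also have "arr T (obj F ?XX) (obj F X) (arr F ?XX X \<pi>) y =
          arr T X (obj F X) \<xi> (arr T R X (restrict \<pi> R) t')"
        unfolding y_def
        by (rule functor_square[OF T(1) R FXX X FX \<sigma> functor_arr[OF F(1) XX X \<pi>] _ \<xi> _ t'(1)])
           (use \<pi> eq in \<open>auto simp: R_def PiE_mem\<close>)
      also have "arr T R X (restrict \<pi> R) t' = arr T ?XX X \<pi> t"
        unfolding t'(2)[symmetric]
        by (rule functor_compose[OF T(1) R XX X inclR \<pi> _ _ t'(1), symmetric])
           (use \<pi> in \<open>auto simp: R_def PiE_mem\<close>)
      also have "arr F (obj T X) X \<alpha> (\<zeta> X (arr T X (obj F X) \<xi> (arr T ?XX X \<pi> t))) =
          \<xi> (\<alpha> (arr T ?XX X \<pi> t))"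
      proof -
        have "compose (obj T X) (arr F (obj T X) X \<alpha>)
            (compose (obj T X) (\<zeta> X) (arr T X (obj F X) \<xi>)) = compose (obj T X) \<xi> \<alpha>"
          using bialg by (simp add: bialgebra_def)
        from fun_cong[OF this, of "arr T ?XX X \<pi> t"] PiE_mem[OF T\<pi> t]
        show ?thesis by (simp add: compose_eq)
      qed
      finally show ?thesis .
    qed
    have "\<And>c. c \<in> R \<Longrightarrow> arr F ?XX X (proj1 pair X) (\<sigma> c) = \<xi> (proj1 pair X c)"
      "\<And>c. c \<in> R \<Longrightarrow> arr F ?XX X (proj2 pair X) (\<sigma> c) = \<xi> (proj2 pair X c)"
      using \<sigma>\<tau> by (simp_all add: \<sigma>_def)
    from marginal[OF proj1_mem this(1)] marginal[OF proj2_mem this(2)]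
    show ?thesis by (simp only: coalgebra_map_def comp_def map_prod_simp)
  qed
  finally show ?thesis .
qed

theorem theorem30:
  fixes U :: "'u set set"
    and pair :: "'u \<times> 'u \<Rightarrow> 'u"
    and val :: "'v::ccd_quantale \<Rightarrow> 'u"
    and F T :: "'u endofunctor"
    and \<zeta> :: "'u set \<Rightarrow> 'u \<Rightarrow> 'u"
    and X :: "'u set"
    and \<alpha> \<xi> :: "'u \<Rightarrow> 'u"
  assumes "set_universe U pair val"
    and "is_functor U F"
    and "is_functor U T"
    and "preserves_weak_pullbacks U T"
    and "preserves_intersections U F"
    and "monotone_wasserstein U pair val F"
    and "natural_transformation U (T \<odot> F) (F \<odot> T) \<zeta>"
    and "X \<in> U"
    and "bialgebra T F \<zeta> X \<alpha> \<xi>"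
  shows "compatible X (coalgebra_map pair val F X \<xi>) (algebra_map pair val T X \<alpha>)"
proof -
  interpret lattice_universe U pair val using assms(1) by (simp add: lattice_universe_def)
  let ?XX = "prod_set pair X"
  \<comment> \<open>The left-hand side is a join over \<open>\<alpha>\<close>-preimages, couplings
    \<open>t\<close> and thresholds \<open>r\<close>; here \<open>t\<close> is fixed and the
    thresholds are treated.\<close>
  have "can_pred_lifting val T ?XX (coalgebra_map pair val F X \<xi> d \<circ> inv pair) t \<le>
      coalgebra_map pair val F X \<xi> (algebra_map pair val T X \<alpha> d)
        (\<alpha> (arr T ?XX X (proj1 pair X) t), \<alpha> (arr T ?XX X (proj2 pair X) t))"
    if t: "t \<in> obj T ?XX" for d t
    unfolding can_pred_lifting_def[of _ T]
  proof (rule Sup_least, unfold mem_Collect_eq)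
    fix r assume "arr T ?XX (range val) (coded val ?XX (coalgebra_map pair val F X \<xi> d \<circ> inv pair)) t
      \<in> image_up val T r"
    \<comment> \<open>By complete distributivity this join is \<open>r\<close>, so it suffices to
      bound every \<open>r'\<close> totally below \<open>r\<close>.\<close>
    hence "Sup {r'. r' \<lless> r} \<le> coalgebra_map pair val F X \<xi> (algebra_map pair val T X \<alpha> d)
        (\<alpha> (arr T ?XX X (proj1 pair X) t), \<alpha> (arr T ?XX X (proj2 pair X) t))"
      using totally_below_le_coalgebra_algebra_map[OF assms(2,6,3,4,7,8,9) t]
      by (intro Sup_least) blast
    thus "r \<le> coalgebra_map pair val F X \<xi> (algebra_map pair val T X \<alpha> d)
        (\<alpha> (arr T ?XX X (proj1 pair X) t), \<alpha> (arr T ?XX X (proj2 pair X) t))"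
      using ccd[of r] by simp
  qed
  \<comment> \<open>The two outer joins remain: over pairs of \<open>\<alpha>\<close>-preimages and
    over their couplings.\<close>
  thus ?thesis
    unfolding compatible_def rel_le_def algebra_map_def[of _ _ T X \<alpha> "coalgebra_map _ _ _ _ _ _"]
      push_forward_def can_wasserstein_def[of _ _ T] Let_def
    by (auto intro!: Sup_least)
qed

end
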